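(* Let $\mathcal{A}$ be a unital Banach algebra and let $a,b\in\mathcal{A}$ satisfy $ab^n=b^{n+1}$ and $ba^n=a^{n+1}$ for some positive integer $n$. Then $$\sigma_*(a)\setminus\{0\}=\sigma_*(b)\setminus\{0\}$$ for each $*\in\{ld, rd, lg, rg, lgd, rgd\}$.
   Context: $\mathcal{A}$ is a complex unital Banach algebra, $r(\cdot)$ denotes the spectral radius, and $\mathcal{A}^{qnil}=\{a\in\mathcal{A}: r(a)=0\}$. Let $a\in\mathcal{A}$. - $a$ is left Drazin invertible if there are $x\in\mathcal{A}$ and a non-negative integer $j$ with $axa=xa^2$, $x^2a=x$, $xa^{j+1}=a^j$; it is right Drazin invertible if there are $y\in\mathcal{A}$ and a non-negative integer $j$ with $aya=a^2y$, $ay^2=y$, $a^{j+1}y=a^j$. - $a$ is left (resp. right) group invertible if the corresponding identities hold with $j=1$. - $a$ is left generalized Drazin invertible if there is $x\in\mathcal{A}$ with $axa=xa^2$, $x^2a=x$, $axa-a\in\mathcal{A}^{qnil}$; it is right generalized Drazin invertible if there is $y\in\mathcal{A}$ with $aya=a^2y$, $ay^2=y$, $aya-a\in\mathcal{A}^{qnil}$. The sets $\sigma_{ld}(a),\sigma_{rd}(a),\sigma_{lg}(a),\sigma_{rg}(a),\sigma_{lgd}(a),\sigma_{rgd}(a)$ are the sets of $\lambda\in\mathbb{C}$ such that $\lambda-a$ is not, respectively, left Drazin invertible, right Drazin invertible, left group invertible, right group invertible, left generalized Drazin invertible, right generalized Drazin invertible in $\mathcal{A}$. *)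

theory Defs
  imports "HOL-Analysis.Analysis"
begin

text \<open>
  The distribution only has real normed algebras. A complex scalar multiplication is added
  here, extending the given real one. As in \<^class>\<open>real_normed_algebra_1\<close>, the unit has norm 1.
\<close>

class complex_banach_algebra_1 = real_normed_algebra_1 + banach +
  fixes scaleC :: "complex \<Rightarrow> 'a \<Rightarrow> 'a"  (infixr \<open>*\<^sub>C\<close> 75)
  assumes scaleC_add_right: "z *\<^sub>C (x + y) = z *\<^sub>C x + z *\<^sub>C y"
    and scaleC_add_left: "(z + w) *\<^sub>C x = z *\<^sub>C x + w *\<^sub>C x"
    and scaleC_scaleC: "z *\<^sub>C (w *\<^sub>C x) = (z * w) *\<^sub>C x"
    and scaleC_of_real: "complex_of_real t *\<^sub>C x = t *\<^sub>R x"
    and mult_scaleC_left: "(z *\<^sub>C x) * y = z *\<^sub>C (x * y)"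
    and mult_scaleC_right: "x * (z *\<^sub>C y) = z *\<^sub>C (x * y)"
    and norm_scaleC: "norm (z *\<^sub>C x) = cmod z * norm x"

instantiation complex :: complex_banach_algebra_1
begin

definition scaleC_complex :: "complex \<Rightarrow> complex \<Rightarrow> complex" where
  "scaleC_complex z x = z * x"

instance
  by standard (simp_all add: scaleC_complex_def algebra_simps norm_mult scaleR_conv_of_real)

end

definition two_sided_invertible :: "'a::monoid_mult \<Rightarrow> bool" where
  "two_sided_invertible a \<longleftrightarrow> (\<exists>x. x * a = 1 \<and> a * x = 1)"

definition spectrum :: "'a::complex_banach_algebra_1 \<Rightarrow> complex set" where
  "spectrum a = {\<mu>. \<not> two_sided_invertible (\<mu> *\<^sub>C 1 - a)}"

text \<open>
  The supremum is taken in \<open>[0, \<infinity>]\<close>, where it always exists; since the spectrum is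
  nonempty and compact, this is the usual real number.
\<close>

definition spectral_radius :: "'a::complex_banach_algebra_1 \<Rightarrow> ennreal" where
  "spectral_radius a = (SUP \<mu>\<in>spectrum a. ennreal (cmod \<mu>))"

definition qnil :: "'a::complex_banach_algebra_1 set" where
  "qnil = {a. spectral_radius a = 0}"

definition left_drazin_inverse :: "nat \<Rightarrow> 'a::monoid_mult \<Rightarrow> 'a \<Rightarrow> bool" where
  "left_drazin_inverse j a x \<longleftrightarrow> a * x * a = x * a^2 \<and> x^2 * a = x \<and> x * a^(j + 1) = a^j"

definition right_drazin_inverse :: "nat \<Rightarrow> 'a::monoid_mult \<Rightarrow> 'a \<Rightarrow> bool" where
  "right_drazin_inverse j a y \<longleftrightarrow> a * y * a = a^2 * y \<and> a * y^2 = y \<and> a^(j + 1) * y = a^j"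

definition left_drazin_invertible :: "'a::complex_banach_algebra_1 \<Rightarrow> bool" where
  "left_drazin_invertible a \<longleftrightarrow> (\<exists>x j. left_drazin_inverse j a x)"

definition right_drazin_invertible :: "'a::complex_banach_algebra_1 \<Rightarrow> bool" where
  "right_drazin_invertible a \<longleftrightarrow> (\<exists>y j. right_drazin_inverse j a y)"

definition left_group_invertible :: "'a::complex_banach_algebra_1 \<Rightarrow> bool" where
  "left_group_invertible a \<longleftrightarrow> (\<exists>x. left_drazin_inverse 1 a x)"

definition right_group_invertible :: "'a::complex_banach_algebra_1 \<Rightarrow> bool" where
  "right_group_invertible a \<longleftrightarrow> (\<exists>y. right_drazin_inverse 1 a y)"

definition left_gen_drazin_invertible :: "'a::complex_banach_algebra_1 \<Rightarrow> bool" where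
  "left_gen_drazin_invertible a \<longleftrightarrow>
     (\<exists>x. a * x * a = x * a^2 \<and> x^2 * a = x \<and> a * x * a - a \<in> qnil)"

definition right_gen_drazin_invertible :: "'a::complex_banach_algebra_1 \<Rightarrow> bool" where
  "right_gen_drazin_invertible a \<longleftrightarrow>
     (\<exists>y. a * y * a = a^2 * y \<and> a * y^2 = y \<and> a * y * a - a \<in> qnil)"

definition sigma_ld :: "'a::complex_banach_algebra_1 \<Rightarrow> complex set" where
  "sigma_ld a = {\<mu>. \<not> left_drazin_invertible (\<mu> *\<^sub>C 1 - a)}"

definition sigma_rd :: "'a::complex_banach_algebra_1 \<Rightarrow> complex set" where
  "sigma_rd a = {\<mu>. \<not> right_drazin_invertible (\<mu> *\<^sub>C 1 - a)}"

definition sigma_lg :: "'a::complex_banach_algebra_1 \<Rightarrow> complex set" where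
  "sigma_lg a = {\<mu>. \<not> left_group_invertible (\<mu> *\<^sub>C 1 - a)}"

definition sigma_rg :: "'a::complex_banach_algebra_1 \<Rightarrow> complex set" where
  "sigma_rg a = {\<mu>. \<not> right_group_invertible (\<mu> *\<^sub>C 1 - a)}"

definition sigma_lgd :: "'a::complex_banach_algebra_1 \<Rightarrow> complex set" where
  "sigma_lgd a = {\<mu>. \<not> left_gen_drazin_invertible (\<mu> *\<^sub>C 1 - a)}"

definition sigma_rgd :: "'a::complex_banach_algebra_1 \<Rightarrow> complex set" where
  "sigma_rgd a = {\<mu>. \<not> right_gen_drazin_invertible (\<mu> *\<^sub>C 1 - a)}"

end

theory Submission
  imports Defs
begin

text \<open>
  Fix \<open>\<mu> \<noteq> 0\<close>. Each of the six one-sided invertibility properties of \<open>c = \<mu> - a\<close> says that some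
  idempotent \<open>p\<close> commuting with \<open>c\<close> splits it: \<open>c\<close> has a one-sided inverse relative to \<open>1 - p\<close>,
  while \<open>cp\<close> is zero (group), nilpotent (Drazin) or quasinilpotent (generalized Drazin).

  The hypotheses make \<open>a\<close> and \<open>b\<close> agree, as left multiplications, on the ranges of
  \<open>a\<^sup>n\<close> and \<open>b\<^sup>n\<close>, and the behaviour of an element near \<open>\<mu> \<noteq> 0\<close> is decided on the
  range of its powers. Indeed \<open>ap = \<mu>p - cp\<close> is invertible in the corner of \<open>p\<close>, so there is
  \<open>w\<close> in this corner, commuting with \<open>a\<close>, with \<open>w a\<^sup>n = p\<close>. As \<open>w = a\<^sup>n w\<^sup>2\<close> has its range in that
  of \<open>a\<^sup>n\<close>, one gets \<open>bw = aw\<close>, hence \<open>b\<^sup>n w = p\<close>. Therefore \<open>q = w b\<^sup>n\<close> is an idempotent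
  commuting with \<open>b\<close>, and it plays for \<open>\<mu> - b\<close> the part that \<open>p\<close> plays for \<open>\<mu> - a\<close>:

  \<^item> Nilpotency passes over because \<open>(\<mu> - b)\<^sup>k q = (\<mu> - a)\<^sup>k w b\<^sup>n\<close>.
  \<^item> Quasinilpotency passes over because \<open>(\<mu> - b) q\<close> and \<open>(\<mu> - a) p\<close> are the products of
    \<open>(\<mu> - a) w\<close> and \<open>b\<^sup>n\<close> in the two orders, which have the same nonzero spectrum.
  \<^item> If \<open>u\<close> is a one-sided inverse of \<open>1 - a\<close> relative to \<open>1 - p\<close> (now with \<open>\<mu> = 1\<close>), then
    \<open>1 + b + \<dots> + b\<^bsup>n-1\<^esup> + u b\<^sup>n\<close>, cut down by \<open>1 - q\<close>, is one of \<open>1 - b\<close> relative to \<open>1 - q\<close>.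
    This is the expansion of \<open>(1 - b)\<^sup>-\<^sup>1\<close> with its tail \<open>(1 - b)\<^sup>-\<^sup>1 b\<^sup>n\<close> replaced by \<open>u b\<^sup>n\<close>.

  Scaling reduces every \<open>\<mu> \<noteq> 0\<close> to \<open>\<mu> = 1\<close>, and the hypotheses are symmetric in \<open>a\<close> and \<open>b\<close>.
\<close>

section \<open>Spectral idempotents\<close>

text \<open>
  An equation \<open>u c = 1 - p\<close> is asked for without placing \<open>u\<close> in the corner of \<open>1 - p\<close>: compressing
  \<open>u\<close> to the corner preserves the equation, so nothing is lost, and such a \<open>u\<close> is easier to build.
\<close>

definition left_spectral_idempotent :: "'a::ring_1 \<Rightarrow> 'a \<Rightarrow> bool" where
  "left_spectral_idempotent c p \<longleftrightarrow> p * p = p \<and> p * c = c * p \<and> (\<exists>u. u * c = 1 - p)"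

definition right_spectral_idempotent :: "'a::ring_1 \<Rightarrow> 'a \<Rightarrow> bool" where
  "right_spectral_idempotent c p \<longleftrightarrow> p * p = p \<and> p * c = c * p \<and> (\<exists>u. c * u = 1 - p)"

text \<open>
  From an inverse \<open>x\<close> the idempotent is \<open>1 - x c\<close>; conversely the compression \<open>(1 - p) u (1 - p)\<close>
  satisfies the two identities shared by all kinds of left Drazin inverse.
\<close>
lemma left_spectral_idempotent_iff:
  "left_spectral_idempotent c p \<longleftrightarrow>
     (\<exists>x. c * x * c = x * c^2 \<and> x^2 * c = x \<and> x * c = 1 - p)"
proof
  assume "left_spectral_idempotent c p"
  then obtain u where p: "p * p = p" "p * c = c * p" and u: "u * c = 1 - p"
    by (auto simp: left_spectral_idempotent_def)
  define e where "e = 1 - p"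
  have e: "e * e = e" "e * c = c * e" "u * c = e"
    using p u by (simp_all add: e_def algebra_simps)
  define x where "x = e * u * e"
  have xc: "x * c = e"
    unfolding x_def by (metis e mult.assoc)
  have "x * e = x"
    by (simp add: x_def mult.assoc e)
  then have "c * x * c = x * c^2" "x^2 * c = x"
    using xc by (simp_all add: mult.assoc power2_eq_square e)
      (simp add: e flip: mult.assoc)
  with xc show "\<exists>x. c * x * c = x * c^2 \<and> x^2 * c = x \<and> x * c = 1 - p"
    unfolding e_def by blast
next
  assume "\<exists>x. c * x * c = x * c^2 \<and> x^2 * c = x \<and> x * c = 1 - p"
  then obtain x where x: "c * x * c = x * c^2" "x^2 * c = x" "x * c = 1 - p"
    by blast
  have "(x * c) * (x * c) = x * (c * x * c)" "x * (x * c^2) = x^2 * c * c"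
    by (simp_all add: mult.assoc power2_eq_square)
  with x have "(1 - p) * (1 - p) = 1 - p"
    by simp
  moreover have "(1 - p) * c = c * (1 - p)"
    by (metis x(1,3) mult.assoc power2_eq_square)
  ultimately show "left_spectral_idempotent c p"
    using x(3) by (auto simp: left_spectral_idempotent_def algebra_simps)
qed

lemma right_spectral_idempotent_iff:
  "right_spectral_idempotent c p \<longleftrightarrow>
     (\<exists>y. c * y * c = c^2 * y \<and> c * y^2 = y \<and> c * y = 1 - p)"
proof
  assume "right_spectral_idempotent c p"
  then obtain u where p: "p * p = p" "p * c = c * p" and u: "c * u = 1 - p"
    by (auto simp: right_spectral_idempotent_def)
  define e where "e = 1 - p"
  have e: "e * e = e" "e * c = c * e" "c * u = e"
    using p u by (simp_all add: e_def algebra_simps)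
  define y where "y = e * u * e"
  have cy: "c * y = e"
    unfolding y_def by (metis e mult.assoc)
  have "e * y = y"
    by (simp add: y_def e flip: mult.assoc)
  then have "c * y * c = c^2 * y" "c * y^2 = y"
    using cy e(2) by (metis mult.assoc power2_eq_square)+
  with cy show "\<exists>y. c * y * c = c^2 * y \<and> c * y^2 = y \<and> c * y = 1 - p"
    unfolding e_def by blast
next
  assume "\<exists>y. c * y * c = c^2 * y \<and> c * y^2 = y \<and> c * y = 1 - p"
  then obtain y where y: "c * y * c = c^2 * y" "c * y^2 = y" "c * y = 1 - p"
    by blast
  have "(c * y) * (c * y) = (c * y * c) * y" "c^2 * y * y = c * (c * y^2)"
    by (simp_all add: mult.assoc power2_eq_square)
  with y have "(1 - p) * (1 - p) = 1 - p"
    by simp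
  moreover have "(1 - p) * c = c * (1 - p)"
    by (metis y(1,3) mult.assoc power2_eq_square)
  ultimately show "right_spectral_idempotent c p"
    using y(3) by (auto simp: right_spectral_idempotent_def algebra_simps)
qed

lemma left_drazin_inverse_iff:
  fixes c :: "'a::ring_1"
  shows "(\<exists>x. left_drazin_inverse j c x) \<longleftrightarrow>
    (\<exists>p. left_spectral_idempotent c p \<and> c^j * p = 0)"
proof -
  have comm: "x * c^(j + 1) = c^j * (x * c)" if "c * x * c = x * c^2" for x
  proof -
    have "c * (x * c) = (x * c) * c"
      using that by (simp add: mult.assoc power2_eq_square)
    from power_commuting_commutes[OF this] show ?thesis
      by (simp add: mult.assoc)
  qed
  have "(x * c^(j + 1) = c^j) = (c^j * p = 0)"
    if "c * x * c = x * c^2" "x * c = 1 - p" for x p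
    using comm[OF that(1)] that(2) by (simp add: right_diff_distrib)
  moreover have "\<exists>p. x * c = 1 - p" for x
    by (rule exI[of _ "1 - x * c"]) simp
  ultimately show ?thesis
    unfolding left_drazin_inverse_def left_spectral_idempotent_iff by metis
qed

lemma right_drazin_inverse_iff:
  fixes c :: "'a::ring_1"
  shows "(\<exists>y. right_drazin_inverse j c y) \<longleftrightarrow>
    (\<exists>p. right_spectral_idempotent c p \<and> c^j * p = 0)"
proof -
  have "(c^(j + 1) * y = c^j) = (c^j * p = 0)" if "c * y = 1 - p" for y p
    using that by (simp add: power_Suc2 mult.assoc right_diff_distrib del: power_Suc)
  moreover have "\<exists>p. c * y = 1 - p" for y
    by (rule exI[of _ "1 - c * y"]) simp
  ultimately show ?thesis
    unfolding right_drazin_inverse_def right_spectral_idempotent_iff by metis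
qed

section \<open>Quasinilpotent elements\<close>

lemma scaleC_one [simp]: "1 *\<^sub>C x = (x :: 'a::complex_banach_algebra_1)"
  using scaleC_of_real[of 1 x] by simp

lemma scaleC_minus_one: "(-1) *\<^sub>C x = - (x :: 'a::complex_banach_algebra_1)"
  using scaleC_of_real[of "-1" x] by simp

lemma scaleC_zero_right [simp]: "z *\<^sub>C (0 :: 'a::complex_banach_algebra_1) = 0"
  using scaleC_add_right[of z "0::'a" 0] by simp

lemma scaleC_diff_right: "z *\<^sub>C (x - y) = z *\<^sub>C x - z *\<^sub>C (y :: 'a::complex_banach_algebra_1)"
  using scaleC_add_right[of z "x - y" y] by (simp add: algebra_simps)

lemma scaleC_power: "(z *\<^sub>C x) ^ k = z ^ k *\<^sub>C (x ^ k :: 'a::complex_banach_algebra_1)"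
  by (induction k) (simp_all add: mult_scaleC_left mult_scaleC_right scaleC_scaleC mult.commute)

lemma scaleC_eq_0_iff:
  "z \<noteq> 0 \<Longrightarrow> z *\<^sub>C x = 0 \<longleftrightarrow> x = (0 :: 'a::complex_banach_algebra_1)"
  by (metis scaleC_zero_right scaleC_scaleC scaleC_one left_inverse)

lemma two_sided_invertible_scaleC:
  fixes x :: "'a::complex_banach_algebra_1"
  assumes "z \<noteq> 0" "two_sided_invertible x"
  shows "two_sided_invertible (z *\<^sub>C x)"
proof -
  obtain y where "y * x = 1" "x * y = 1"
    using assms(2) by (auto simp: two_sided_invertible_def)
  then have "(inverse z *\<^sub>C y) * (z *\<^sub>C x) = 1" "(z *\<^sub>C x) * (inverse z *\<^sub>C y) = 1"
    using assms(1) by (simp_all add: mult_scaleC_left mult_scaleC_right scaleC_scaleC)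
  then show ?thesis
    by (auto simp: two_sided_invertible_def)
qed

text \<open>
  With the inverse of the spectral parameter as variable, the condition has no exceptional value,
  and it is visibly preserved by scaling and by interchanging factors.
\<close>
lemma qnil_iff:
  "c \<in> qnil \<longleftrightarrow> (\<forall>z. two_sided_invertible (1 - z *\<^sub>C c))"
proof -
  have "c \<in> qnil \<longleftrightarrow> (\<forall>\<mu>\<in>spectrum c. \<mu> = 0)"
    unfolding qnil_def spectral_radius_def mem_Collect_eq
      SUP_bot_conv(1)[where 'a = ennreal, unfolded bot_ennreal]
    by (simp add: ennreal_eq_0_iff)
  also have "\<dots> \<longleftrightarrow> (\<forall>\<mu>. \<mu> \<noteq> 0 \<longrightarrow> two_sided_invertible (\<mu> *\<^sub>C 1 - c))"
    by (auto simp: spectrum_def)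
  also have "\<dots> \<longleftrightarrow> (\<forall>z. two_sided_invertible (1 - z *\<^sub>C c))"
  proof safe
    fix z
    assume *: "\<forall>\<mu>. \<mu> \<noteq> 0 \<longrightarrow> two_sided_invertible (\<mu> *\<^sub>C 1 - c)"
    show "two_sided_invertible (1 - z *\<^sub>C c)"
    proof (cases "z = 0")
      case True
      have "0 *\<^sub>C c = 0" using scaleC_of_real[of 0 c] by simp
      then show ?thesis using True by (auto simp: two_sided_invertible_def)
    next
      case False
      have "z *\<^sub>C (inverse z *\<^sub>C 1 - c) = 1 - z *\<^sub>C c"
        using False by (simp add: scaleC_diff_right scaleC_scaleC)
      with * two_sided_invertible_scaleC[OF False] False show ?thesis
        by (metis inverse_nonzero_iff_nonzero)
    qed
  next
    fix \<mu> :: complex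
    assume *: "\<forall>z. two_sided_invertible (1 - z *\<^sub>C c)" and "\<mu> \<noteq> 0"
    have "\<mu> *\<^sub>C (1 - inverse \<mu> *\<^sub>C c) = \<mu> *\<^sub>C 1 - c"
      using \<open>\<mu> \<noteq> 0\<close> by (simp add: scaleC_diff_right scaleC_scaleC)
    with * two_sided_invertible_scaleC[OF \<open>\<mu> \<noteq> 0\<close>] show "two_sided_invertible (\<mu> *\<^sub>C 1 - c)"
      by metis
  qed
  finally show ?thesis .
qed

lemma scaleC_qnil: "c \<in> qnil \<Longrightarrow> z *\<^sub>C c \<in> qnil"
  by (simp add: qnil_iff scaleC_scaleC)

lemma minus_qnil_iff: "- c \<in> qnil \<longleftrightarrow> c \<in> qnil"
  using scaleC_qnil[of c "-1"] scaleC_qnil[of "-c" "-1"] by (auto simp: scaleC_minus_one)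

lemma geometric_sum_left: "(1 - x) * (\<Sum>i<k. x ^ i) = 1 - (x :: 'a::ring_1) ^ k"
  by (induction k) (simp_all add: distrib_left, simp add: left_diff_distrib)

lemma geometric_sum_right: "(\<Sum>i<k. x ^ i) * (1 - x) = 1 - (x :: 'a::ring_1) ^ k"
  by (induction k) (simp_all add: distrib_right, simp add: right_diff_distrib power_commutes)

text \<open>A terminating geometric series inverts \<open>1 - z c\<close> for every \<open>z\<close>.\<close>
lemma nilpotent_imp_qnil:
  fixes c :: "'a::complex_banach_algebra_1"
  assumes "c ^ k = 0"
  shows "c \<in> qnil"
  unfolding qnil_iff two_sided_invertible_def
  using geometric_sum_left[of "_ *\<^sub>C c" k] geometric_sum_right[of "_ *\<^sub>C c" k] assms
  by (auto simp: scaleC_power)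

text \<open>
  Jacobson's lemma. The inverse \<open>1 + y z x\<close> is read off from the formal series
  \<open>1 + yx + yxyx + \<dots> = 1 + y (1 + xy + \<dots>) x\<close>.
\<close>
lemma two_sided_invertible_one_minus_mult_swap:
  fixes x y :: "'a::ring_1"
  assumes "two_sided_invertible (1 - x * y)"
  shows "two_sided_invertible (1 - y * x)"
proof -
  obtain z where z: "z * (1 - x * y) = 1" "(1 - x * y) * z = 1"
    using assms by (auto simp: two_sided_invertible_def)
  have "(1 + y * z * x) * (1 - y * x) = 1 - y * x + y * (z * (1 - x * y)) * x"
    "(1 - y * x) * (1 + y * z * x) = 1 - y * x + y * ((1 - x * y) * z) * x"
    by (simp_all add: algebra_simps)
  with z show ?thesis
    by (auto simp: two_sided_invertible_def intro!: exI[of _ "1 + y * z * x"])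
qed

lemma qnil_mult_swap:
  assumes "x * y \<in> qnil"
  shows "y * x \<in> qnil"
  unfolding qnil_iff
proof
  fix z
  have "two_sided_invertible (1 - (z *\<^sub>C x) * y)"
    using assms by (simp add: qnil_iff mult_scaleC_left)
  from two_sided_invertible_one_minus_mult_swap[OF this]
  show "two_sided_invertible (1 - z *\<^sub>C (y * x))"
    by (simp add: mult_scaleC_right)
qed

lemma left_gen_drazin_invertible_iff:
  "left_gen_drazin_invertible c \<longleftrightarrow> (\<exists>p. left_spectral_idempotent c p \<and> c * p \<in> qnil)"
proof -
  have "c * x * c - c \<in> qnil \<longleftrightarrow> c * p \<in> qnil" if "x * c = 1 - p" for x p
    using that minus_qnil_iff[of "c * p"] by (simp add: mult.assoc right_diff_distrib)
  moreover have "\<exists>p. x * c = 1 - p" for x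
    by (rule exI[of _ "1 - x * c"]) simp
  ultimately show ?thesis
    unfolding left_gen_drazin_invertible_def left_spectral_idempotent_iff by metis
qed

lemma right_gen_drazin_invertible_iff:
  "right_gen_drazin_invertible c \<longleftrightarrow> (\<exists>p. right_spectral_idempotent c p \<and> c * p \<in> qnil)"
proof -
  have "c * y * c - c \<in> qnil \<longleftrightarrow> c * p \<in> qnil"
    if "c * y = 1 - p" "c * y * c = c^2 * y" for y p
    using that minus_qnil_iff[of "c * p"]
    by (simp add: mult.assoc right_diff_distrib power2_eq_square)
  moreover have "\<exists>p. c * y = 1 - p" for y
    by (rule exI[of _ "1 - c * y"]) simp
  ultimately show ?thesis
    unfolding right_gen_drazin_invertible_def right_spectral_idempotent_iff by metis
qed

section \<open>Transfer of the idempotent at the point 1\<close>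

text \<open>
  The last two assumptions say that \<open>w\<close> is inverse to \<open>a\<^sup>n\<close> in the corner of the idempotent
  \<open>w a\<^sup>n\<close>. This idempotent is the given one for \<open>1 - a\<close>, and \<open>w b\<^sup>n\<close> is the one to be
  found for \<open>1 - b\<close>.
\<close>

locale intertwined_powers =
  fixes a b w :: "'a::ring_1" and n :: nat
  assumes ab: "a * b ^ n = b ^ (n + 1)"
    and ba: "b * a ^ n = a ^ (n + 1)"
    and w_commutes: "w * a = a * w"
    and w_inverse: "w * w * a ^ n = w"
begin

abbreviation p where "p \<equiv> w * a ^ n"
abbreviation q where "q \<equiv> w * b ^ n"

lemma a_pow_b: "a ^ k * b ^ n = b ^ k * b ^ n"
proof (induction k)
  case (Suc k)
  have "a ^ Suc k * b ^ n = a ^ k * (a * b ^ n)"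
    by (simp add: power_Suc2 mult.assoc del: power_Suc)
  also have "\<dots> = (a ^ k * b ^ n) * b"
    by (simp add: ab mult.assoc flip: power_Suc2)
  also have "\<dots> = b ^ Suc k * b ^ n"
    by (simp add: Suc mult.assoc power_commutes) (simp add: power_commutes flip: mult.assoc)
  finally show ?case .
qed simp

lemma w_pow_commutes: "a ^ k * w = w * a ^ k"
  using power_commuting_commutes[OF w_commutes[symmetric], of k] .

lemma a_pow_w_w: "a ^ n * (w * w) = w"
  by (metis w_inverse w_pow_commutes mult.assoc)

text \<open>
  Where the second intertwining relation enters: \<open>w = a\<^sup>n w\<^sup>2\<close> lies in the right ideal generated by
  \<open>a\<^sup>n\<close>, on which left multiplication by \<open>b\<close> and by \<open>a\<close> agree.
\<close>
lemma b_w: "b * w = a * w"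
  by (metis a_pow_w_w ba mult.assoc power_Suc Suc_eq_plus1)

lemma b_pow_w: "b ^ k * w = w * a ^ k"
proof (induction k)
  case (Suc k)
  then show ?case
    by (metis b_w mult.assoc power_Suc w_commutes)
qed simp

lemma p_w: "p * w = w" and w_p: "w * p = w"
  by (metis mult.assoc w_inverse w_pow_commutes)+

lemma q_idempotent: "q * q = q"
  by (metis b_pow_w mult.assoc w_p)

lemma q_commutes: "q * b = b * q"
proof -
  have "q * b = w * (a * b ^ n)"
    by (simp add: ab mult.assoc power_commutes)
  then show ?thesis
    by (simp add: b_w w_commutes flip: mult.assoc)
qed

lemma one_minus_b_pow_w: "(1 - b) ^ k * w = (1 - a) ^ k * w"
proof (induction k)
  case (Suc k)
  have "(1 - a) ^ k * w = w * (1 - a) ^ k"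
    by (rule power_commuting_commutes) (simp add: algebra_simps w_commutes)
  moreover have "(1 - b) * w = (1 - a) * w"
    by (simp add: left_diff_distrib b_w)
  ultimately show ?case
    using Suc by (metis mult.assoc power_Suc)
qed simp

lemma pow_q_eq_0:
  assumes "(1 - a) ^ k * p = 0"
  shows "(1 - b) ^ k * q = 0"
proof -
  have "(1 - b) ^ k * q = (1 - a) ^ k * (p * w) * b ^ n"
    unfolding p_w by (simp add: one_minus_b_pow_w flip: mult.assoc)
  also have "\<dots> = ((1 - a) ^ k * p) * w * b ^ n"
    by (simp only: mult.assoc)
  finally show ?thesis by (simp add: assms)
qed

text \<open>
  Since \<open>(1 - b) b\<^sup>n = (1 - a) b\<^sup>n\<close>, the element \<open>v = 1 + \<dots> + b\<^bsup>n-1\<^esup> + u b\<^sup>n\<close> satisfies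
  \<open>v (1 - b) = 1 - p b\<^sup>n\<close>, and \<open>p b\<^sup>n q = p b\<^sup>n\<close>. So multiplication by \<open>1 - q\<close> turns this into \<open>1 - q\<close>.
\<close>
lemma left_spectral_idempotent_q:
  assumes "left_spectral_idempotent (1 - a) p"
  shows "left_spectral_idempotent (1 - b) q"
proof -
  obtain u where u: "u * (1 - a) = 1 - p"
    using assms by (auto simp: left_spectral_idempotent_def)
  define S where "S = (\<Sum>i<n. b ^ i)"
  have "(u * b ^ n) * (1 - b) = (u * (1 - a)) * b ^ n"
    by (simp add: algebra_simps ab power_commutes)
  then have V: "(S + u * b ^ n) * (1 - b) = 1 - p * b ^ n"
    unfolding distrib_right S_def geometric_sum_right u by (simp add: left_diff_distrib)
  have "(1 - q) * (1 - b) = (1 - b) * (1 - q)"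
    using q_commutes by (simp only: left_diff_distrib right_diff_distrib) simp
  then have "(S + u * b ^ n) * (1 - q) * (1 - b) = (S + u * b ^ n) * (1 - b) * (1 - q)"
    by (simp only: mult.assoc)
  moreover have "(p * b ^ n) * q = p * b ^ n"
    by (metis b_pow_w mult.assoc w_p)
  ultimately have "(S + u * b ^ n) * (1 - q) * (1 - b) = 1 - q"
    unfolding V by (simp only: left_diff_distrib right_diff_distrib) simp
  moreover have "q * (1 - b) = (1 - b) * q"
    by (simp add: left_diff_distrib right_diff_distrib q_commutes)
  ultimately show ?thesis
    unfolding left_spectral_idempotent_def using q_idempotent by blast
qed

text \<open>
  The same element \<open>v\<close> works, but now \<open>1 - b\<close> meets \<open>u\<close> before \<open>b\<^sup>n\<close>. Expanding
  \<open>u = (1 + \<dots> + a\<^bsup>n-1\<^esup>) (1 - p) + a\<^sup>n u\<close> splits \<open>u\<close> into parts on which \<open>1 - b\<close> can be evaluated,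
  and gives \<open>(1 - b) u b\<^sup>n = (1 - p) b\<^sup>n\<close>.
\<close>
lemma right_spectral_idempotent_q:
  assumes "right_spectral_idempotent (1 - a) p"
  shows "right_spectral_idempotent (1 - b) q"
proof -
  obtain u where u: "(1 - a) * u = 1 - p"
    using assms by (auto simp: right_spectral_idempotent_def)
  define S where "S = (\<Sum>i<n. b ^ i)"
  define T where "T = (\<Sum>i<n. a ^ i)"
  have TS: "T * b ^ n = S * b ^ n"
    by (simp add: T_def S_def sum_distrib_right a_pow_b)
  have u_eq: "u = T * (1 - p) + a ^ n * u"
  proof -
    have "T * (1 - p) = (1 - a ^ n) * u"
      by (simp only: T_def geometric_sum_right flip: mult.assoc u)
    then show ?thesis by (simp add: left_diff_distrib)
  qed
  have Tw: "(1 - b) * (T * w) = (1 - a) * (T * w)"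
  proof -
    have "T * w = w * T"
      by (simp add: T_def sum_distrib_left sum_distrib_right w_pow_commutes)
    then show ?thesis by (simp add: left_diff_distrib b_w flip: mult.assoc)
  qed
  have Tp: "(1 - b) * (T * p) = (1 - a ^ n) * p"
    using Tw by (simp add: geometric_sum_left T_def flip: mult.assoc)
  have "(1 - b) * (u * b ^ n)
      = (1 - b) * S * b ^ n - (1 - b) * (T * p) * b ^ n + (1 - b) * a ^ n * u * b ^ n"
    by (subst u_eq) (simp add: algebra_simps TS)
  also have "(1 - b) * a ^ n * u = a ^ n * ((1 - a) * u)"
    by (simp add: left_diff_distrib right_diff_distrib ba power_commutes flip: mult.assoc)
  also have "(1 - b) * S = 1 - b ^ n"
    by (simp add: S_def geometric_sum_left)
  finally have "(1 - b) * (u * b ^ n) = (1 - p) * b ^ n"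
    unfolding Tp u using a_pow_b[of n] by (simp add: left_diff_distrib right_diff_distrib)
  then have V: "(1 - b) * (S + u * b ^ n) = 1 - p * b ^ n"
    unfolding distrib_left S_def geometric_sum_left by (simp add: left_diff_distrib)
  have "(1 - b) * (1 - q) = (1 - q) * (1 - b)"
    using q_commutes by (simp only: left_diff_distrib right_diff_distrib) simp
  then have "(1 - b) * ((1 - q) * (S + u * b ^ n)) = (1 - q) * ((1 - b) * (S + u * b ^ n))"
    by (simp only: flip: mult.assoc)
  moreover have "q * (p * b ^ n) = p * b ^ n"
  proof -
    have "q * (p * b ^ n) = w * (b ^ n * w) * a ^ n * b ^ n"
      by (simp only: mult.assoc)
    also have "\<dots> = (w * p) * a ^ n * b ^ n"
      unfolding b_pow_w ..
    finally show ?thesis unfolding w_p .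
  qed
  ultimately have "(1 - b) * ((1 - q) * (S + u * b ^ n)) = 1 - q"
    unfolding V by (simp only: left_diff_distrib right_diff_distrib) simp
  moreover have "q * (1 - b) = (1 - b) * q"
    by (simp add: left_diff_distrib right_diff_distrib q_commutes)
  ultimately show ?thesis
    unfolding right_spectral_idempotent_def using q_idempotent by blast
qed

end

text \<open>
  Both elements are products of \<open>(1 - a) w\<close> and \<open>b\<^sup>n\<close>, in opposite orders:
  \<open>((1 - a) w) b\<^sup>n = (1 - b) q\<close> and \<open>b\<^sup>n ((1 - a) w) = (1 - a) p\<close>.
\<close>
lemma qnil_transfer:
  fixes a b w :: "'a::complex_banach_algebra_1"
  assumes "intertwined_powers a b w n" and "(1 - a) * (w * a ^ n) \<in> qnil"
  shows "(1 - b) * (w * b ^ n) \<in> qnil"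
proof -
  interpret intertwined_powers a b w n by fact
  have "b ^ n * ((1 - a) * w) = (1 - a) * p"
    using w_commutes b_pow_w[of n] w_pow_commutes
    by (simp add: algebra_simps) (metis mult.assoc power_commutes)
  with assms(2) have "((1 - a) * w) * b ^ n \<in> qnil"
    by (metis qnil_mult_swap)
  moreover have "(1 - b) * q = (1 - a) * w * b ^ n"
    by (simp add: left_diff_distrib b_w flip: mult.assoc)
  ultimately show ?thesis by simp
qed

text \<open>
  In the corner of \<open>p\<close> the element \<open>a\<close> is the unit minus a quasinilpotent element. The inverse of
  \<open>a\<^sup>n\<close> there is obtained from the element \<open>d = 1 - (1 - a) p\<close>, which is
  invertible in the whole algebra, commutes with \<open>a\<close> and \<open>p\<close>, and satisfies \<open>d p = a p\<close>.
\<close>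
lemma corner_inverse_exists:
  fixes a p :: "'a::complex_banach_algebra_1"
  assumes p: "p * p = p" "p * a = a * p" and qnil: "(1 - a) * p \<in> qnil"
  obtains w where "w * a = a * w" "w * w * a ^ n = w" "w * a ^ n = p"
proof -
  define d where "d = 1 - (1 - a) * p"
  have "two_sided_invertible d"
    using qnil[unfolded qnil_iff, rule_format, of 1] by (simp add: d_def)
  then obtain z where z: "z * d = 1" "d * z = 1"
    by (auto simp: two_sided_invertible_def)
  have z_comm: "z * y = y * z" if "y * d = d * y" for y
    by (metis that z mult.assoc mult_1_left mult_1_right)
  have za: "z * a = a * z" and zp: "z * p = p * z"
    by (rule z_comm; simp add: d_def algebra_simps p; metis p mult.assoc)+
  have dp: "d * p = a * p"
    using p by (simp add: d_def algebra_simps)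
  have pa: "p * a ^ k = a ^ k * p" for k
    using power_commuting_commutes[OF p(2)[symmetric]] by simp
  have "d ^ k * p = a ^ k * p" for k
  proof (induction k)
    case (Suc k)
    then have "d ^ Suc k * p = (d * p) * a ^ k"
      by (simp add: mult.assoc pa)
    then show ?case
      by (simp add: dp mult.assoc pa)
  qed simp
  moreover have "z ^ n * d ^ n = 1"
    using z(1) by (rule left_right_inverse_power)
  ultimately have za_p: "z ^ n * (a ^ n * p) = p"
    by (metis mult.assoc mult_1_left)
  have zn: "z ^ n * a = a * z ^ n" "z ^ n * p = p * z ^ n"
    using power_commuting_commutes[OF za] power_commuting_commutes[OF zp] by auto
  define w where "w = z ^ n * p"
  show thesis
  proof (rule that[of w])
    show "w * a = a * w"
      unfolding w_def using zn p(2) by (metis mult.assoc)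
    show wa: "w * a ^ n = p"
      unfolding w_def by (simp add: mult.assoc pa za_p)
    show "w * w * a ^ n = w"
      by (simp add: mult.assoc wa) (simp add: w_def mult.assoc p(1))
  qed
qed

lemma spectral_idempotent_transfer_at_1:
  fixes a b :: "'a::complex_banach_algebra_1"
  assumes ab: "a * b ^ n = b ^ (n + 1)" and ba: "b * a ^ n = a ^ (n + 1)"
    and p: "p * p = p" "p * (1 - a) = (1 - a) * p" "(1 - a) * p \<in> qnil"
  obtains q where
    "left_spectral_idempotent (1 - a) p \<Longrightarrow> left_spectral_idempotent (1 - b) q"
    "right_spectral_idempotent (1 - a) p \<Longrightarrow> right_spectral_idempotent (1 - b) q"
    "(1 - b) * q \<in> qnil"
    "\<And>k. (1 - a) ^ k * p = 0 \<Longrightarrow> (1 - b) ^ k * q = 0"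
proof -
  have "p * a = a * p"
    using p(2) by (simp add: left_diff_distrib right_diff_distrib)
  then obtain w where w: "w * a = a * w" "w * w * a ^ n = w" "w * a ^ n = p"
    using corner_inverse_exists p(1,3) by blast
  interpret intertwined_powers a b w n
    using ab ba w by unfold_locales
  show thesis
    by (rule that[of q]) (use left_spectral_idempotent_q right_spectral_idempotent_q pow_q_eq_0
      qnil_transfer[OF intertwined_powers_axioms] p(3) w(3) in simp_all)
qed

section \<open>Transfer at nonzero points\<close>

lemma left_spectral_idempotent_scaleC:
  fixes c :: "'a::complex_banach_algebra_1"
  assumes "z \<noteq> 0" "left_spectral_idempotent c p"
  shows "left_spectral_idempotent (z *\<^sub>C c) p"
proof -
  obtain u where u: "u * c = 1 - p"
    using assms(2) by (auto simp: left_spectral_idempotent_def)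
  have "(inverse z *\<^sub>C u) * (z *\<^sub>C c) = 1 - p"
    using assms(1) u by (simp add: mult_scaleC_left mult_scaleC_right scaleC_scaleC)
  moreover have "p * p = p" "p * (z *\<^sub>C c) = (z *\<^sub>C c) * p"
    using assms(2) by (simp_all add: left_spectral_idempotent_def mult_scaleC_left mult_scaleC_right)
  ultimately show ?thesis
    unfolding left_spectral_idempotent_def by blast
qed

lemma right_spectral_idempotent_scaleC:
  fixes c :: "'a::complex_banach_algebra_1"
  assumes "z \<noteq> 0" "right_spectral_idempotent c p"
  shows "right_spectral_idempotent (z *\<^sub>C c) p"
proof -
  obtain u where u: "c * u = 1 - p"
    using assms(2) by (auto simp: right_spectral_idempotent_def)
  have "(z *\<^sub>C c) * (inverse z *\<^sub>C u) = 1 - p"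
    using assms(1) u by (simp add: mult_scaleC_left mult_scaleC_right scaleC_scaleC)
  moreover have "p * p = p" "p * (z *\<^sub>C c) = (z *\<^sub>C c) * p"
    using assms(2) by (simp_all add: right_spectral_idempotent_def mult_scaleC_left mult_scaleC_right)
  ultimately show ?thesis
    unfolding right_spectral_idempotent_def by blast
qed

lemma spectral_idempotent_transfer:
  fixes a b :: "'a::complex_banach_algebra_1"
  assumes ab: "a * b ^ n = b ^ (n + 1)" and ba: "b * a ^ n = a ^ (n + 1)" and "\<mu> \<noteq> 0"
    and p: "p * p = p" "p * (\<mu> *\<^sub>C 1 - a) = (\<mu> *\<^sub>C 1 - a) * p" "(\<mu> *\<^sub>C 1 - a) * p \<in> qnil"
  obtains q where
    "left_spectral_idempotent (\<mu> *\<^sub>C 1 - a) p \<Longrightarrow> left_spectral_idempotent (\<mu> *\<^sub>C 1 - b) q"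
    "right_spectral_idempotent (\<mu> *\<^sub>C 1 - a) p \<Longrightarrow> right_spectral_idempotent (\<mu> *\<^sub>C 1 - b) q"
    "(\<mu> *\<^sub>C 1 - b) * q \<in> qnil"
    "\<And>k. (\<mu> *\<^sub>C 1 - a) ^ k * p = 0 \<Longrightarrow> (\<mu> *\<^sub>C 1 - b) ^ k * q = 0"
proof -
  define z where "z = inverse \<mu>"
  have z: "z \<noteq> 0" using \<open>\<mu> \<noteq> 0\<close> by (simp add: z_def)
  have down: "1 - z *\<^sub>C x = z *\<^sub>C (\<mu> *\<^sub>C 1 - x)" and up: "\<mu> *\<^sub>C 1 - x = \<mu> *\<^sub>C (1 - z *\<^sub>C x)" for x :: 'a
    using \<open>\<mu> \<noteq> 0\<close> by (simp_all add: z_def scaleC_diff_right scaleC_scaleC)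
  have "(z *\<^sub>C a) * (z *\<^sub>C b) ^ n = (z *\<^sub>C b) ^ (n + 1)"
    "(z *\<^sub>C b) * (z *\<^sub>C a) ^ n = (z *\<^sub>C a) ^ (n + 1)"
    unfolding scaleC_power
    by (simp_all add: mult_scaleC_left mult_scaleC_right scaleC_scaleC ab ba mult.commute)
  moreover have "p * (1 - z *\<^sub>C a) = (1 - z *\<^sub>C a) * p" "(1 - z *\<^sub>C a) * p \<in> qnil"
    unfolding down using p(2) scaleC_qnil[OF p(3), of z]
    by (simp_all add: mult_scaleC_left mult_scaleC_right)
  ultimately obtain q where q:
    "left_spectral_idempotent (1 - z *\<^sub>C a) p \<Longrightarrow> left_spectral_idempotent (1 - z *\<^sub>C b) q"
    "right_spectral_idempotent (1 - z *\<^sub>C a) p \<Longrightarrow> right_spectral_idempotent (1 - z *\<^sub>C b) q"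
    "(1 - z *\<^sub>C b) * q \<in> qnil"
    "\<And>k. (1 - z *\<^sub>C a) ^ k * p = 0 \<Longrightarrow> (1 - z *\<^sub>C b) ^ k * q = 0"
    using spectral_idempotent_transfer_at_1 p(1) by metis
  show thesis
  proof (rule that[of q])
    show "left_spectral_idempotent (\<mu> *\<^sub>C 1 - b) q" if "left_spectral_idempotent (\<mu> *\<^sub>C 1 - a) p"
      using left_spectral_idempotent_scaleC[OF z that] q(1)
        left_spectral_idempotent_scaleC[OF \<open>\<mu> \<noteq> 0\<close>] by (metis down up)
    show "right_spectral_idempotent (\<mu> *\<^sub>C 1 - b) q" if "right_spectral_idempotent (\<mu> *\<^sub>C 1 - a) p"
      using right_spectral_idempotent_scaleC[OF z that] q(2)
        right_spectral_idempotent_scaleC[OF \<open>\<mu> \<noteq> 0\<close>] by (metis down up)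
    show "(\<mu> *\<^sub>C 1 - b) * q \<in> qnil"
      unfolding up using scaleC_qnil[OF q(3), of \<mu>] by (simp add: mult_scaleC_left)
    show "(\<mu> *\<^sub>C 1 - b) ^ k * q = 0" if "(\<mu> *\<^sub>C 1 - a) ^ k * p = 0" for k
      using q(4)[of k] that \<open>\<mu> \<noteq> 0\<close>
      unfolding up by (simp add: scaleC_power mult_scaleC_left scaleC_eq_0_iff)
  qed
qed

text \<open>
  The exponent is raised by one because \<open>(c p)\<^sup>k = c\<^sup>k p\<close> can fail for \<open>k = 0\<close>.
\<close>
lemma pow_mult_eq_0_imp_qnil:
  fixes c :: "'a::complex_banach_algebra_1"
  assumes "p * p = p" "p * c = c * p" "c ^ k * p = 0"
  shows "c * p \<in> qnil"
proof (rule nilpotent_imp_qnil)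
  have "(c * p) ^ j * p = c ^ j * p" for j
  proof (induction j)
    case (Suc j)
    have "(c * p) ^ Suc j * p = c * p * (c ^ j * p)"
      by (simp add: Suc mult.assoc)
    also have "p * c ^ j = c ^ j * p"
      using power_commuting_commutes[OF assms(2)[symmetric]] by simp
    then have "c * p * (c ^ j * p) = c ^ Suc j * p"
      by (metis assms(1) mult.assoc power_Suc)
    finally show ?case .
  qed simp
  moreover have "(c * p) ^ Suc k = (c * p) ^ k * p * c"
    by (simp add: assms(2) power_Suc2 mult.assoc del: power_Suc)
  ultimately show "(c * p) ^ Suc k = 0"
    using assms(3) by simp
qed

text \<open>
  The index \<open>j\<close> is the same on both sides, so that the case \<open>j = 1\<close> covers group invertibility.
\<close>
lemma one_sided_drazin_transfer:
  fixes a b :: "'a::complex_banach_algebra_1"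
  assumes ab: "a * b ^ n = b ^ (n + 1)" and ba: "b * a ^ n = a ^ (n + 1)" and "\<mu> \<noteq> 0"
  shows "\<exists>x. left_drazin_inverse j (\<mu> *\<^sub>C 1 - a) x \<Longrightarrow> \<exists>x. left_drazin_inverse j (\<mu> *\<^sub>C 1 - b) x"
    and "\<exists>y. right_drazin_inverse j (\<mu> *\<^sub>C 1 - a) y \<Longrightarrow> \<exists>y. right_drazin_inverse j (\<mu> *\<^sub>C 1 - b) y"
    and "left_gen_drazin_invertible (\<mu> *\<^sub>C 1 - a) \<Longrightarrow> left_gen_drazin_invertible (\<mu> *\<^sub>C 1 - b)"
    and "right_gen_drazin_invertible (\<mu> *\<^sub>C 1 - a) \<Longrightarrow> right_gen_drazin_invertible (\<mu> *\<^sub>C 1 - b)"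
proof -
  show "\<exists>x. left_drazin_inverse j (\<mu> *\<^sub>C 1 - b) x" if "\<exists>x. left_drazin_inverse j (\<mu> *\<^sub>C 1 - a) x"
  proof -
    obtain p where p: "left_spectral_idempotent (\<mu> *\<^sub>C 1 - a) p" "(\<mu> *\<^sub>C 1 - a) ^ j * p = 0"
      using \<open>\<exists>x. left_drazin_inverse j (\<mu> *\<^sub>C 1 - a) x\<close> unfolding left_drazin_inverse_iff by blast
    have comm: "p * p = p" "p * (\<mu> *\<^sub>C 1 - a) = (\<mu> *\<^sub>C 1 - a) * p"
      using p(1) by (simp_all add: left_spectral_idempotent_def)
    from comm p(2) have "(\<mu> *\<^sub>C 1 - a) * p \<in> qnil"
      by (rule pow_mult_eq_0_imp_qnil)
    from spectral_idempotent_transfer[OF assms comm this] obtain q where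
      "left_spectral_idempotent (\<mu> *\<^sub>C 1 - b) q" "(\<mu> *\<^sub>C 1 - b) ^ j * q = 0"
      using p by metis
    then show ?thesis
      unfolding left_drazin_inverse_iff by blast
  qed
  show "\<exists>x. right_drazin_inverse j (\<mu> *\<^sub>C 1 - b) x" if "\<exists>y. right_drazin_inverse j (\<mu> *\<^sub>C 1 - a) y"
  proof -
    obtain p where p: "right_spectral_idempotent (\<mu> *\<^sub>C 1 - a) p" "(\<mu> *\<^sub>C 1 - a) ^ j * p = 0"
      using \<open>\<exists>y. right_drazin_inverse j (\<mu> *\<^sub>C 1 - a) y\<close> unfolding right_drazin_inverse_iff by blast
    have comm: "p * p = p" "p * (\<mu> *\<^sub>C 1 - a) = (\<mu> *\<^sub>C 1 - a) * p"
      using p(1) by (simp_all add: right_spectral_idempotent_def)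
    from comm p(2) have "(\<mu> *\<^sub>C 1 - a) * p \<in> qnil"
      by (rule pow_mult_eq_0_imp_qnil)
    from spectral_idempotent_transfer[OF assms comm this] obtain q where
      "right_spectral_idempotent (\<mu> *\<^sub>C 1 - b) q" "(\<mu> *\<^sub>C 1 - b) ^ j * q = 0"
      using p by metis
    then show ?thesis
      unfolding right_drazin_inverse_iff by blast
  qed
  show "left_gen_drazin_invertible (\<mu> *\<^sub>C 1 - b)" if "left_gen_drazin_invertible (\<mu> *\<^sub>C 1 - a)"
  proof -
    obtain p where p: "left_spectral_idempotent (\<mu> *\<^sub>C 1 - a) p" "(\<mu> *\<^sub>C 1 - a) * p \<in> qnil"
      using \<open>left_gen_drazin_invertible (\<mu> *\<^sub>C 1 - a)\<close> unfolding left_gen_drazin_invertible_iff by blast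
    have comm: "p * p = p" "p * (\<mu> *\<^sub>C 1 - a) = (\<mu> *\<^sub>C 1 - a) * p"
      using p(1) by (simp_all add: left_spectral_idempotent_def)
    from spectral_idempotent_transfer[OF assms comm p(2)] obtain q where
      "left_spectral_idempotent (\<mu> *\<^sub>C 1 - b) q" "(\<mu> *\<^sub>C 1 - b) * q \<in> qnil"
      using p(1) by metis
    then show ?thesis
      unfolding left_gen_drazin_invertible_iff by blast
  qed
  show "right_gen_drazin_invertible (\<mu> *\<^sub>C 1 - b)" if "right_gen_drazin_invertible (\<mu> *\<^sub>C 1 - a)"
  proof -
    obtain p where p: "right_spectral_idempotent (\<mu> *\<^sub>C 1 - a) p" "(\<mu> *\<^sub>C 1 - a) * p \<in> qnil"
      using \<open>right_gen_drazin_invertible (\<mu> *\<^sub>C 1 - a)\<close> unfolding right_gen_drazin_invertible_iff by blast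
    have comm: "p * p = p" "p * (\<mu> *\<^sub>C 1 - a) = (\<mu> *\<^sub>C 1 - a) * p"
      using p(1) by (simp_all add: right_spectral_idempotent_def)
    from spectral_idempotent_transfer[OF assms comm p(2)] obtain q where
      "right_spectral_idempotent (\<mu> *\<^sub>C 1 - b) q" "(\<mu> *\<^sub>C 1 - b) * q \<in> qnil"
      using p(1) by metis
    then show ?thesis
      unfolding right_gen_drazin_invertible_iff by blast
  qed
qed

lemma sigma_subset:
  fixes a b :: "'a::complex_banach_algebra_1"
  assumes "a * b ^ n = b ^ (n + 1)" and "b * a ^ n = a ^ (n + 1)"
  shows "sigma_ld b - {0} \<subseteq> sigma_ld a" "sigma_rd b - {0} \<subseteq> sigma_rd a"
    "sigma_lg b - {0} \<subseteq> sigma_lg a" "sigma_rg b - {0} \<subseteq> sigma_rg a"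
    "sigma_lgd b - {0} \<subseteq> sigma_lgd a" "sigma_rgd b - {0} \<subseteq> sigma_rgd a"
  using one_sided_drazin_transfer[OF assms]
  by (auto simp: sigma_ld_def sigma_rd_def sigma_lg_def sigma_rg_def sigma_lgd_def sigma_rgd_def
      left_drazin_invertible_def right_drazin_invertible_def
      left_group_invertible_def right_group_invertible_def, blast+)

theorem corollary4p7:
  fixes a b :: "'a::complex_banach_algebra_1" and n :: nat
  assumes "n > 0"
    and "a * b ^ n = b ^ (n + 1)"
    and "b * a ^ n = a ^ (n + 1)"
  shows "sigma_ld a - {0} = sigma_ld b - {0}
       \<and> sigma_rd a - {0} = sigma_rd b - {0}
       \<and> sigma_lg a - {0} = sigma_lg b - {0}
       \<and> sigma_rg a - {0} = sigma_rg b - {0}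
       \<and> sigma_lgd a - {0} = sigma_lgd b - {0}
       \<and> sigma_rgd a - {0} = sigma_rgd b - {0}"
  using sigma_subset[OF assms(2,3)] sigma_subset[OF assms(3,2)] by blast

end
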